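(* Let $\alpha,\beta>-1$. Then for all $x,y\in[-1,1]$ and $t\ge2\log2$ $$\Big|G_t^{\alpha,\beta}(x,y)-\frac{1}{h_0^{\alpha,\beta}}\Big|\le\frac{\Gamma(\alpha+\beta+2)}{2^{\alpha+\beta}\,\Gamma(\alpha\wedge\beta+2)\,\Gamma(\alpha\vee\beta+1)}\,e^{-(t-1)(\alpha+\beta+2)}\qquad\text{when }\alpha\vee\beta\ge-1/2,$$ and $$\Big|G_t^{\alpha,\beta}(x,y)-\frac{1}{h_0^{\alpha,\beta}}\Big|\le\frac{27\,\Gamma(\alpha+\beta+2)}{5\cdot2^{\alpha+\beta+2}\,\Gamma(\alpha+2)\,\Gamma(\beta+2)}\,e^{-(t-1)(\alpha+\beta+2)}\qquad\text{when }\alpha\vee\beta<-1/2.$$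
   Context: $\alpha\vee\beta=\max(\alpha,\beta)$, $\alpha\wedge\beta=\min(\alpha,\beta)$ (executed before addition). For $\alpha,\beta>-1$ the Jacobi heat kernel is $$G_t^{\alpha,\beta}(x,y)=\sum_{n=0}^\infty e^{-tn(n+\alpha+\beta+1)}\,\frac{P_n^{\alpha,\beta}(x)P_n^{\alpha,\beta}(y)}{h_n^{\alpha,\beta}},\qquad x,y\in[-1,1],\ t>0,$$ where $P_n^{\alpha,\beta}$ are the classical Jacobi polynomials (Szeg\H{o}'s normalization, $P_n^{\alpha,\beta}(1)=\binom{n+\alpha}{n}$) and $h_n^{\alpha,\beta}=\int_{-1}^1 (P_n^{\alpha,\beta}(x))^2(1-x)^\alpha(1+x)^\beta\,dx$. In particular $h_0^{\alpha,\beta}=\dfrac{2^{\alpha+\beta+1}\Gamma(\alpha+1)\Gamma(\beta+1)}{\Gamma(\alpha+\beta+2)}$. *)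

theory Defs
  imports "HOL-Analysis.Analysis"
begin

(* Szego's explicit formula, i.e. Rodrigues' formula
     (1-x)^a (1+x)^b P_n(x) = (-1)^n / (2^n n!) (d/dx)^n [(1-x)^(n+a) (1+x)^(n+b)]
   expanded by the Leibniz rule.  Unlike the hypergeometric form it involves no division by
   parameters, so it needs no case distinction at a + b + 1 = 0. *)
definition jacobi_poly :: "real \<Rightarrow> real \<Rightarrow> nat \<Rightarrow> real \<Rightarrow> real" where
  "jacobi_poly \<alpha> \<beta> n x =
     (\<Sum>s\<le>n. ((real n + \<alpha>) gchoose (n - s)) * ((real n + \<beta>) gchoose s)
              * ((x - 1) / 2) ^ s * ((x + 1) / 2) ^ (n - s))"

lemma jacobi_poly_at_1: "jacobi_poly \<alpha> \<beta> n 1 = (real n + \<alpha>) gchoose n"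
proof -
  have "jacobi_poly \<alpha> \<beta> n 1 = (\<Sum>s\<le>n. if s = 0 then (real n + \<alpha>) gchoose n else 0)"
    unfolding jacobi_poly_def by (rule sum.cong) auto
  then show ?thesis by simp
qed

(* For a negative exponent the weight takes the value 0 at the corresponding endpoint
   (0 powr a = 0); this changes the integrand on a null set only. *)
definition jacobi_h :: "real \<Rightarrow> real \<Rightarrow> nat \<Rightarrow> real" where
  "jacobi_h \<alpha> \<beta> n =
     integral {-1..1} (\<lambda>x. (jacobi_poly \<alpha> \<beta> n x)\<^sup>2 * (1 - x) powr \<alpha> * (1 + x) powr \<beta>)"

definition jacobi_heat_kernel :: "real \<Rightarrow> real \<Rightarrow> real \<Rightarrow> real \<Rightarrow> real \<Rightarrow> real" where
  "jacobi_heat_kernel \<alpha> \<beta> t x y =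
     (\<Sum>n. exp (- t * real n * (real n + \<alpha> + \<beta> + 1))
           * (jacobi_poly \<alpha> \<beta> n x * jacobi_poly \<alpha> \<beta> n y / jacobi_h \<alpha> \<beta> n))"

end

theory Submission
  imports Defs
begin

text \<open>
  Put \<open>u = \<alpha> + \<beta> + 2\<close> and \<open>w = max \<alpha> \<beta> + 1\<close>. The coefficients in Szego's formula are positive up to
  the sign \<open>(-1)\<^sup>s\<close>, and by Vandermonde they add up to the binomial coefficient
  \<open>B\<^sub>n = (2 n + \<alpha> + \<beta>) gchoose n\<close>, so that \<open>\<bar>P\<^sub>n\<bar> \<le> B\<^sub>n\<close> on the interval. The same sum appears in
  \<open>h\<^sub>n\<close>: the polynomial \<open>P\<^sub>n\<close> is orthogonal to lower degrees and \<open>B\<^sub>n\<close> is its leading coefficient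
  in \<open>(1 - x) / 2\<close>, up to sign. Hence \<open>B\<^sub>n\<^sup>2 / h\<^sub>n\<close> is explicit.

  The bound \<open>B\<^sub>n\<close> is far from sharp, but for \<open>n \<ge> 2\<close> and \<open>t \<ge> 2 ln 2\<close> the heat factor compensates: the
  terms decay at least like powers of 1/12. For \<open>n = 1\<close> the sharp bound \<open>w\<close> is used. The first term
  and the remaining tail each contribute at most half of the first bound. When \<open>max \<alpha> \<beta> < -1/2\<close>, the
  second bound exceeds the first, as \<open>w < 1/2\<close>.
\<close>

section \<open>Finite differences of binomial coefficients\<close>

text \<open>Pascal's rule, read as: a difference of order \<open>Suc n\<close> is the difference of
  order \<open>n\<close> of the first differences.\<close>

lemma alternating_choose_sum_Suc:
  fixes f :: "nat \<Rightarrow> 'a :: comm_ring_1"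
  shows "(\<Sum>s\<le>Suc n. (-1) ^ s * of_nat (Suc n choose s) * f s) =
         (\<Sum>s\<le>n. (-1) ^ s * of_nat (n choose s) * (f s - f (Suc s)))"
proof -
  have "(\<Sum>s\<le>Suc n. (-1) ^ s * of_nat (Suc n choose s) * f s) =
      f 0 - (\<Sum>s\<le>n. (-1) ^ s * of_nat (n choose s) * f (Suc s))
        - (\<Sum>s\<le>n. (-1) ^ s * of_nat (n choose Suc s) * f (Suc s))"
    by (simp add: sum.atMost_Suc_shift algebra_simps sum.distrib sum_negf sum_subtractf del: sum.atMost_Suc)
  also have "f 0 - (\<Sum>s\<le>n. (-1) ^ s * of_nat (n choose s) * f (Suc s))
        - (\<Sum>s\<le>n. (-1) ^ s * of_nat (n choose Suc s) * f (Suc s)) =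
      (\<Sum>s\<le>Suc n. (-1) ^ s * of_nat (n choose s) * f s)
        - (\<Sum>s\<le>n. (-1) ^ s * of_nat (n choose s) * f (Suc s))"
    by (simp add: sum.atMost_Suc_shift sum_negf del: sum.atMost_Suc)
  also have "\<dots> = (\<Sum>s\<le>n. (-1) ^ s * of_nat (n choose s) * (f s - f (Suc s)))"
    by (simp add: algebra_simps sum_subtractf binomial_eq_0)
  finally show ?thesis .
qed

text \<open>As a function of \<open>s\<close> the binomial is a polynomial of degree
  \<open>k\<close>, and each difference lowers the degree by one. Hence \<open>k\<close> varies in
  the induction.\<close>

lemma alternating_choose_sum_gbinomial:
  fixes x :: "'a :: field_char_0"
  assumes "k \<le> n"
  shows "(\<Sum>s\<le>n. (-1) ^ s * of_nat (n choose s) * ((x + of_nat s) gchoose k)) =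
         (if k = n then (-1) ^ n else 0)"
  using assms
proof (induction n arbitrary: k)
  case 0
  then show ?case by simp
next
  case (Suc n)
  show ?case
  proof (cases k)
    case 0
    show ?thesis unfolding 0 alternating_choose_sum_Suc by simp
  next
    case (Suc m)
    have "(x + of_nat s gchoose Suc m) - (x + of_nat (Suc s) gchoose Suc m) =
        - (x + of_nat s gchoose m)" for s
      using gbinomial_Suc_Suc[of "x + of_nat s" m] by (simp add: algebra_simps)
    then have "(\<Sum>s\<le>Suc n. (-1) ^ s * of_nat (Suc n choose s) * ((x + of_nat s) gchoose k)) =
        - (\<Sum>s\<le>n. (-1) ^ s * of_nat (n choose s) * ((x + of_nat s) gchoose m))"
      unfolding Suc alternating_choose_sum_Suc by (simp add: sum_negf)
    then show ?thesis
      using Suc.IH[of m] Suc.prems Suc by simp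
  qed
qed

section \<open>Beta integrals for the Jacobi weight\<close>

lemma has_integral_jacobi_weight_moment:
  fixes \<alpha> \<beta> :: real
  assumes "\<alpha> > -1" and "\<beta> > -1"
  shows "((\<lambda>x. ((1 - x) / 2) ^ i * ((1 + x) / 2) ^ j * ((1 - x) powr \<alpha> * (1 + x) powr \<beta>))
           has_integral 2 powr (\<alpha> + \<beta> + 1) * Beta (\<alpha> + real i + 1) (\<beta> + real j + 1)) {-1..1}"
proof -
  define f where "f t = t powr (\<beta> + real j) * (1 - t) powr (\<alpha> + real i)" for t :: real
  have "(f has_integral Beta (\<beta> + real j + 1) (\<alpha> + real i + 1)) (cbox 0 1)"
    using has_integral_Beta_real[of "\<beta> + real j + 1" "\<alpha> + real i + 1"] assms
    unfolding f_def by simp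
  from has_integral_affinity'[OF this, of "1/2" "1/2"]
  have "((\<lambda>x. f ((1 + x) / 2)) has_integral 2 * Beta (\<alpha> + real i + 1) (\<beta> + real j + 1)) {-1..1}"
    by (simp add: Beta_commute add_divide_distrib add.commute)
  from has_integral_mult_right[OF this, of "2 powr (\<alpha> + \<beta>)"]
  have "((\<lambda>x. 2 powr (\<alpha> + \<beta>) * f ((1 + x) / 2)) has_integral
      2 powr (\<alpha> + \<beta> + 1) * Beta (\<alpha> + real i + 1) (\<beta> + real j + 1)) (cbox (-1) 1)"
    by (simp add: powr_add mult.assoc)
  then have "((\<lambda>x. ((1 - x) / 2) ^ i * ((1 + x) / 2) ^ j * ((1 - x) powr \<alpha> * (1 + x) powr \<beta>))
      has_integral 2 powr (\<alpha> + \<beta> + 1) * Beta (\<alpha> + real i + 1) (\<beta> + real j + 1)) (cbox (-1) 1)"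
  \<comment> \<open>Splitting the real exponents into a power and a \<open>powr\<close> uses
    positive bases, so the endpoints are left out as a null set.\<close>
  proof (rule has_integral_spike_interior)
    fix x :: real
    assume x: "x \<in> box (-1) 1"
    have 1: "1 - (1 + x) / 2 = (1 - x) / 2"
      by (simp add: field_simps)
    have 2: "((1 - x) / 2) powr (\<alpha> + real i) = ((1 - x) / 2) ^ i * (1 - x) powr \<alpha> / 2 powr \<alpha>"
      using x by (simp add: powr_add powr_divide powr_realpow[of "(1 - x) / 2", symmetric] mult_ac)
    have 3: "((1 + x) / 2) powr (\<beta> + real j) = ((1 + x) / 2) ^ j * (1 + x) powr \<beta> / 2 powr \<beta>"
      using x by (simp add: powr_add powr_divide powr_realpow[of "(1 + x) / 2", symmetric] mult_ac)
    show "((1 - x) / 2) ^ i * ((1 + x) / 2) ^ j * ((1 - x) powr \<alpha> * (1 + x) powr \<beta>)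
        = 2 powr (\<alpha> + \<beta>) * f ((1 + x) / 2)"
      unfolding f_def 1 2 3 by (simp add: powr_add)
  qed
  then show ?thesis by simp
qed

section \<open>Coefficients in Szego's formula and the crude sup norm bound\<close>

text \<open>The sign stays outside, which makes these numbers positive for \<open>s \<le> n\<close>
  and lets Vandermonde sum them.\<close>

definition jacobi_coeff :: "real \<Rightarrow> real \<Rightarrow> nat \<Rightarrow> nat \<Rightarrow> real" where
  "jacobi_coeff \<alpha> \<beta> n s = ((real n + \<alpha>) gchoose (n - s)) * ((real n + \<beta>) gchoose s)"

lemma jacobi_poly_eq:
  "jacobi_poly \<alpha> \<beta> n x =
     (\<Sum>s\<le>n. (-1) ^ s * jacobi_coeff \<alpha> \<beta> n s * (((1 - x) / 2) ^ s * ((1 + x) / 2) ^ (n - s)))"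
proof -
  have "((x - 1) / 2) ^ s = (-1) ^ s * ((1 - x) / 2) ^ s" for s
    by (metis minus_diff_eq minus_divide_left mult_minus1 power_mult_distrib)
  then show ?thesis
    unfolding jacobi_poly_def jacobi_coeff_def by (simp add: mult_ac add.commute)
qed

lemma sum_jacobi_coeff:
  "(\<Sum>s\<le>n. jacobi_coeff \<alpha> \<beta> n s) = (2 * real n + \<alpha> + \<beta>) gchoose n"
  using gbinomial_Vandermonde[of "real n + \<beta>" "real n + \<alpha>" n]
  by (simp add: jacobi_coeff_def mult_ac add_ac atLeast0AtMost)

lemma gbinomial_pos_real:
  fixes a :: real
  assumes "a > real k - 1"
  shows "a gchoose k > 0"
  using assms by (simp add: gbinomial_pochhammer' pochhammer_pos)

lemma gbinomial_eq_Gamma_quotient: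
  fixes a :: real
  assumes "a > real k - 1"
  shows "a gchoose k = Gamma (a + 1) / (fact k * Gamma (a - real k + 1))"
proof (rule gbinomial_Gamma)
  show "a + 1 \<notin> \<int>\<^sub>\<le>\<^sub>0"
    using assms by (auto elim!: nonpos_Ints_cases)
qed

lemma jacobi_coeff_pos:
  assumes "\<alpha> > -1" and "\<beta> > -1" and "s \<le> n"
  shows "jacobi_coeff \<alpha> \<beta> n s > 0"
  unfolding jacobi_coeff_def using assms
  by (intro mult_pos_pos gbinomial_pos_real) (auto simp: of_nat_diff)

lemma abs_jacobi_poly_le:
  assumes "\<alpha> > -1" and "\<beta> > -1" and "x \<in> {-1..1}"
  shows "\<bar>jacobi_poly \<alpha> \<beta> n x\<bar> \<le> (2 * real n + \<alpha> + \<beta>) gchoose n"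
proof -
  have "\<bar>jacobi_poly \<alpha> \<beta> n x\<bar> \<le>
      (\<Sum>s\<le>n. \<bar>(-1) ^ s * jacobi_coeff \<alpha> \<beta> n s * (((1 - x) / 2) ^ s * ((1 + x) / 2) ^ (n - s))\<bar>)"
    unfolding jacobi_poly_eq by (rule sum_abs)
  also have "\<dots> \<le> (\<Sum>s\<le>n. jacobi_coeff \<alpha> \<beta> n s)"
  proof (rule sum_mono)
    fix s assume s: "s \<in> {..n}"
    have "((1 - x) / 2) ^ s * ((1 + x) / 2) ^ (n - s) \<le> 1"
      using assms(3) by (intro mult_le_one power_le_one) auto
    moreover have "jacobi_coeff \<alpha> \<beta> n s > 0"
      using jacobi_coeff_pos assms s by simp
    ultimately show "\<bar>(-1) ^ s * jacobi_coeff \<alpha> \<beta> n s * (((1 - x) / 2) ^ s * ((1 + x) / 2) ^ (n - s))\<bar>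
        \<le> jacobi_coeff \<alpha> \<beta> n s"
      using assms(3) by (simp add: abs_mult power_abs mult_left_le)
  qed
  finally show ?thesis by (simp add: sum_jacobi_coeff)
qed

section \<open>Orthogonality and the norms \<open>jacobi_h\<close>\<close>

text \<open>After inserting the Beta integrals, the moment is the \<open>n\<close>-th finite difference of a polynomial
  of degree \<open>k\<close>.\<close>

lemma has_integral_jacobi_poly_moment:
  fixes \<alpha> \<beta> :: real
  assumes "\<alpha> > -1" and "\<beta> > -1" and "k \<le> n"
  shows "((\<lambda>x. jacobi_poly \<alpha> \<beta> n x * ((1 - x) / 2) ^ k * ((1 - x) powr \<alpha> * (1 + x) powr \<beta>))
     has_integral (if k = n then (-1) ^ n * (2 powr (\<alpha> + \<beta> + 1) * Gamma (\<alpha> + real n + 1) *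
        Gamma (\<beta> + real n + 1) / Gamma (\<alpha> + \<beta> + 2 + 2 * real n)) else 0)) {-1..1}"
proof -
  \<comment> \<open>\<open>C\<close> collects what does not depend on \<open>s\<close>. The
    factorials of the coefficient form \<open>n choose s\<close> up to \<open>fact n\<close>, and
    the two Gamma values at arguments differing by \<open>k\<close> form the generalized binomial up
    to \<open>fact k\<close>.\<close>
  define C where "C = 2 powr (\<alpha> + \<beta> + 1) * Gamma (\<alpha> + real n + 1) * Gamma (\<beta> + real n + 1) *
    fact k / (fact n * Gamma (\<alpha> + \<beta> + 2 + real n + real k))"
  have summand: "(-1) ^ s * jacobi_coeff \<alpha> \<beta> n s *
      (2 powr (\<alpha> + \<beta> + 1) * Beta (\<alpha> + real (s + k) + 1) (\<beta> + real (n - s) + 1)) =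
      C * ((-1) ^ s * real (n choose s) * ((\<alpha> + real k + real s) gchoose k))"
    if "s \<le> n" for s
  proof -
    have Gp: "Gamma (\<alpha> + real s + 1) > 0" "Gamma (\<beta> + real n - real s + 1) > 0"
      using assms that by (auto intro!: Gamma_real_pos)
    have c: "(real n + \<alpha>) gchoose (n - s) =
        Gamma (\<alpha> + real n + 1) / (fact (n - s) * Gamma (\<alpha> + real s + 1))"
      using gbinomial_eq_Gamma_quotient[of "n - s" "real n + \<alpha>"] assms that
      by (simp add: of_nat_diff algebra_simps)
    have d: "(real n + \<beta>) gchoose s =
        Gamma (\<beta> + real n + 1) / (fact s * Gamma (\<beta> + real n - real s + 1))"
      using gbinomial_eq_Gamma_quotient[of s "real n + \<beta>"] assms that
      by (simp add: algebra_simps)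
    have e: "(\<alpha> + real k + real s) gchoose k =
        Gamma (\<alpha> + real s + real k + 1) / (fact k * Gamma (\<alpha> + real s + 1))"
      using gbinomial_eq_Gamma_quotient[of k "\<alpha> + real k + real s"] assms that
      by (simp add: algebra_simps)
    have b: "Beta (\<alpha> + real (s + k) + 1) (\<beta> + real (n - s) + 1) =
        Gamma (\<alpha> + real s + real k + 1) * Gamma (\<beta> + real n - real s + 1)
          / Gamma (\<alpha> + \<beta> + 2 + real n + real k)"
      using that by (simp add: Beta_def of_nat_diff algebra_simps)
    show ?thesis
      unfolding C_def jacobi_coeff_def c d e b binomial_fact[OF that]
      using Gp by (simp add: field_simps)
  qed
  have "((\<lambda>x. \<Sum>s\<le>n. (-1) ^ s * jacobi_coeff \<alpha> \<beta> n s *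
      (((1 - x) / 2) ^ (s + k) * ((1 + x) / 2) ^ (n - s) * ((1 - x) powr \<alpha> * (1 + x) powr \<beta>)))
      has_integral (\<Sum>s\<le>n. (-1) ^ s * jacobi_coeff \<alpha> \<beta> n s *
        (2 powr (\<alpha> + \<beta> + 1) * Beta (\<alpha> + real (s + k) + 1) (\<beta> + real (n - s) + 1)))) {-1..1}"
    by (intro has_integral_sum has_integral_mult_right has_integral_jacobi_weight_moment assms) auto
  also have "(\<Sum>s\<le>n. (-1) ^ s * jacobi_coeff \<alpha> \<beta> n s *
        (2 powr (\<alpha> + \<beta> + 1) * Beta (\<alpha> + real (s + k) + 1) (\<beta> + real (n - s) + 1))) =
      (\<Sum>s\<le>n. C * ((-1) ^ s * real (n choose s) * ((\<alpha> + real k + real s) gchoose k)))"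
    using summand by (intro sum.cong) auto
  also have "\<dots> = C * (if k = n then (-1) ^ n else 0)"
    using alternating_choose_sum_gbinomial[OF assms(3), of "\<alpha> + real k"]
    by (simp add: sum_distrib_left[symmetric])
  also have "\<dots> = (if k = n then (-1) ^ n * (2 powr (\<alpha> + \<beta> + 1) * Gamma (\<alpha> + real n + 1) *
        Gamma (\<beta> + real n + 1) / Gamma (\<alpha> + \<beta> + 2 + 2 * real n)) else 0)"
    by (simp add: C_def algebra_simps)
  also have "(\<lambda>x. \<Sum>s\<le>n. (-1) ^ s * jacobi_coeff \<alpha> \<beta> n s *
      (((1 - x) / 2) ^ (s + k) * ((1 + x) / 2) ^ (n - s) * ((1 - x) powr \<alpha> * (1 + x) powr \<beta>))) =
      (\<lambda>x. jacobi_poly \<alpha> \<beta> n x * ((1 - x) / 2) ^ k * ((1 - x) powr \<alpha> * (1 + x) powr \<beta>))"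
    unfolding jacobi_poly_eq by (simp add: sum_distrib_right sum_distrib_left power_add mult_ac)
  finally show ?thesis .
qed

text \<open>Replacing one factor \<open>(1 + x) / 2\<close> by \<open>1 - (1 - x) / 2\<close> gives
  a moment of lower total degree, which vanishes, minus one with \<open>k\<close> raised and
  \<open>j\<close> lowered. Each such exchange flips the sign, so that \<open>(-1) ^ n\<close> turns
  into \<open>(-1) ^ k\<close>.\<close>

lemma has_integral_jacobi_poly_mixed_moment:
  fixes \<alpha> \<beta> :: real
  assumes "\<alpha> > -1" and "\<beta> > -1" and "k + j \<le> n"
  shows "((\<lambda>x. jacobi_poly \<alpha> \<beta> n x * ((1 - x) / 2) ^ k * ((1 + x) / 2) ^ j
       * ((1 - x) powr \<alpha> * (1 + x) powr \<beta>))
     has_integral (if k + j = n then (-1) ^ k * (2 powr (\<alpha> + \<beta> + 1) * Gamma (\<alpha> + real n + 1) *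
        Gamma (\<beta> + real n + 1) / Gamma (\<alpha> + \<beta> + 2 + 2 * real n)) else 0)) {-1..1}"
  using assms(3)
proof (induction j arbitrary: k)
  case 0
  then show ?case
    using has_integral_jacobi_poly_moment[OF assms(1,2), of k n] by auto
next
  case (Suc j)
  have eq: "(\<lambda>x. jacobi_poly \<alpha> \<beta> n x * ((1 - x) / 2) ^ k * ((1 + x) / 2) ^ Suc j
        * ((1 - x) powr \<alpha> * (1 + x) powr \<beta>)) =
      (\<lambda>x. jacobi_poly \<alpha> \<beta> n x * ((1 - x) / 2) ^ k * ((1 + x) / 2) ^ j
        * ((1 - x) powr \<alpha> * (1 + x) powr \<beta>)
       - jacobi_poly \<alpha> \<beta> n x * ((1 - x) / 2) ^ Suc k * ((1 + x) / 2) ^ j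
        * ((1 - x) powr \<alpha> * (1 + x) powr \<beta>))"
    by (intro ext) (simp add: field_simps)
  show ?case
    unfolding eq using has_integral_diff[OF Suc.IH[of k] Suc.IH[of "Suc k"]] Suc.prems
    by (auto split: if_splits)
qed

text \<open>Only one factor of the squared polynomial is expanded. Each term then pairs the other
  factor with a product of full degree \<open>n\<close>, and its sign \<open>(-1) ^ s\<close>
  cancels against that of the moment, leaving the sum of the coefficients.\<close>

lemma jacobi_h_eq:
  fixes \<alpha> \<beta> :: real
  assumes "\<alpha> > -1" and "\<beta> > -1"
  shows "jacobi_h \<alpha> \<beta> n = ((2 * real n + \<alpha> + \<beta>) gchoose n) *
    (2 powr (\<alpha> + \<beta> + 1) * Gamma (\<alpha> + real n + 1) * Gamma (\<beta> + real n + 1)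
      / Gamma (\<alpha> + \<beta> + 2 + 2 * real n))"
proof -
  let ?K = "2 powr (\<alpha> + \<beta> + 1) * Gamma (\<alpha> + real n + 1) * Gamma (\<beta> + real n + 1)
      / Gamma (\<alpha> + \<beta> + 2 + 2 * real n)"
  have "((\<lambda>x. \<Sum>s\<le>n. (-1) ^ s * jacobi_coeff \<alpha> \<beta> n s *
      (jacobi_poly \<alpha> \<beta> n x * ((1 - x) / 2) ^ s * ((1 + x) / 2) ^ (n - s)
        * ((1 - x) powr \<alpha> * (1 + x) powr \<beta>)))
      has_integral (\<Sum>s\<le>n. (-1) ^ s * jacobi_coeff \<alpha> \<beta> n s *
        (if s + (n - s) = n then (-1) ^ s * ?K else 0))) {-1..1}"
    by (intro has_integral_sum has_integral_mult_right
        has_integral_jacobi_poly_mixed_moment assms) auto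
  also have "(\<lambda>x. \<Sum>s\<le>n. (-1) ^ s * jacobi_coeff \<alpha> \<beta> n s *
      (jacobi_poly \<alpha> \<beta> n x * ((1 - x) / 2) ^ s * ((1 + x) / 2) ^ (n - s)
        * ((1 - x) powr \<alpha> * (1 + x) powr \<beta>))) =
      (\<lambda>x. (jacobi_poly \<alpha> \<beta> n x)\<^sup>2 * (1 - x) powr \<alpha> * (1 + x) powr \<beta>)"
    unfolding power2_eq_square
    by (subst (3) jacobi_poly_eq) (simp add: sum_distrib_left sum_distrib_right mult_ac)
  also have "(\<Sum>s\<le>n. (-1) ^ s * jacobi_coeff \<alpha> \<beta> n s *
        (if s + (n - s) = n then (-1) ^ s * ?K else 0)) = (\<Sum>s\<le>n. jacobi_coeff \<alpha> \<beta> n s) * ?K"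
    unfolding sum_distrib_right
    by (intro sum.cong) (auto simp: mult_ac simp flip: power_add mult_2)
  finally show ?thesis
    unfolding jacobi_h_def sum_jacobi_coeff by (rule integral_unique)
qed

section \<open>Low degrees, and the majorant of the series terms\<close>

lemma jacobi_poly_0: "jacobi_poly \<alpha> \<beta> 0 x = 1"
  by (simp add: jacobi_poly_def)

text \<open>The polynomial is affine with endpoint values \<open>\<alpha> + 1\<close> and
  \<open>- (\<beta> + 1)\<close>. The crude bound would give their distance
  \<open>\<alpha> + \<beta> + 2\<close> instead of the larger modulus.\<close>

lemma abs_jacobi_poly_1_le:
  assumes "\<alpha> > -1" and "\<beta> > -1" and "x \<in> {-1..1}"
  shows "\<bar>jacobi_poly \<alpha> \<beta> 1 x\<bar> \<le> max \<alpha> \<beta> + 1"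
proof -
  define p where "p = (1 + x) / 2"
  have p: "0 \<le> p" "p \<le> 1" using assms(3) by (auto simp: p_def)
  have "jacobi_poly \<alpha> \<beta> 1 x = (\<alpha> + 1) * p - (\<beta> + 1) * (1 - p)"
    by (simp add: jacobi_poly_def p_def field_simps)
  moreover have "(\<alpha> + 1) * p \<le> (max \<alpha> \<beta> + 1) * p" "(\<beta> + 1) * (1 - p) \<le> (max \<alpha> \<beta> + 1) * (1 - p)"
    using p by (auto intro!: mult_right_mono)
  moreover have "0 \<le> (\<alpha> + 1) * p" "0 \<le> (\<beta> + 1) * (1 - p)"
    "0 \<le> (max \<alpha> \<beta> + 1) * p" "0 \<le> (max \<alpha> \<beta> + 1) * (1 - p)"
    using p assms by auto
  ultimately show ?thesis
    by (simp add: algebra_simps)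
qed

text \<open>The quotient of the squared sup norm bound by \<open>h\<^sub>n\<close>, with one binomial coefficient cancelled.\<close>

definition jacobi_majorant :: "real \<Rightarrow> real \<Rightarrow> nat \<Rightarrow> real" where
  "jacobi_majorant \<alpha> \<beta> n = ((2 * real n + \<alpha> + \<beta>) gchoose n) * Gamma (\<alpha> + \<beta> + 2 + 2 * real n)
     / (2 powr (\<alpha> + \<beta> + 1) * Gamma (\<alpha> + real n + 1) * Gamma (\<beta> + real n + 1))"

lemma jacobi_h_pos:
  assumes "\<alpha> > -1" and "\<beta> > -1" and "n \<ge> 1"
  shows "jacobi_h \<alpha> \<beta> n > 0"
proof -
  have "((2 * real n + \<alpha> + \<beta>) gchoose n) > 0"
    using assms by (intro gbinomial_pos_real) auto
  moreover have "Gamma (\<alpha> + real n + 1) > 0" "Gamma (\<beta> + real n + 1) > 0"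
    "Gamma (\<alpha> + \<beta> + 2 + 2 * real n) > 0"
    using assms by (auto intro!: Gamma_real_pos)
  ultimately show ?thesis
    unfolding jacobi_h_eq[OF assms(1,2)] by simp
qed

lemma jacobi_majorant_eq:
  assumes "\<alpha> > -1" and "\<beta> > -1" and "n \<ge> 1"
  shows "jacobi_majorant \<alpha> \<beta> n = ((2 * real n + \<alpha> + \<beta>) gchoose n)\<^sup>2 / jacobi_h \<alpha> \<beta> n"
proof -
  have "((2 * real n + \<alpha> + \<beta>) gchoose n) > 0"
    using assms by (intro gbinomial_pos_real) auto
  moreover have "Gamma (\<alpha> + real n + 1) > 0" "Gamma (\<beta> + real n + 1) > 0"
    "Gamma (\<alpha> + \<beta> + 2 + 2 * real n) > 0"
    using assms by (auto intro!: Gamma_real_pos)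
  ultimately show ?thesis
    unfolding jacobi_h_eq[OF assms(1,2)] jacobi_majorant_def
    by (simp add: power2_eq_square field_simps)
qed

lemma abs_jacobi_poly_mult_le:
  assumes "\<alpha> > -1" and "\<beta> > -1" and "x \<in> {-1..1}" and "y \<in> {-1..1}" and "n \<ge> 1"
  shows "\<bar>jacobi_poly \<alpha> \<beta> n x * jacobi_poly \<alpha> \<beta> n y / jacobi_h \<alpha> \<beta> n\<bar> \<le> jacobi_majorant \<alpha> \<beta> n"
proof -
  have "\<bar>jacobi_poly \<alpha> \<beta> n x * jacobi_poly \<alpha> \<beta> n y\<bar> \<le> ((2 * real n + \<alpha> + \<beta>) gchoose n)\<^sup>2"
    unfolding abs_mult power2_eq_square
    using abs_jacobi_poly_le[OF assms(1,2,3), of n] abs_jacobi_poly_le[OF assms(1,2,4), of n]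
    by (intro mult_mono) auto
  then show ?thesis
    using jacobi_h_pos[OF assms(1,2,5)]
    unfolding jacobi_majorant_eq[OF assms(1,2,5)] abs_divide by (simp add: divide_right_mono)
qed

lemma Gamma_add_one_pos:
  fixes z :: real
  assumes "z > 0"
  shows "Gamma (z + 1) = z * Gamma z"
  using assms by (intro Gamma_plus1) (auto elim!: nonpos_Ints_cases)

text \<open>The binomial contributes \<open>v * (v - 1)\<close> and the Gamma function
  \<open>v * (v + 1)\<close> to the numerator. For \<open>n \<ge> 1\<close> the factor
  \<open>real n + \<alpha> + \<beta> + 1\<close> is positive.\<close>

lemma jacobi_majorant_Suc:
  fixes \<alpha> \<beta> :: real
  assumes "\<alpha> > -1" and "\<beta> > -1" and "n \<ge> 1"
  defines "v \<equiv> 2 * real n + \<alpha> + \<beta> + 2"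
  shows "jacobi_majorant \<alpha> \<beta> (Suc n) = jacobi_majorant \<alpha> \<beta> n * (v\<^sup>2 * (v\<^sup>2 - 1)
    / ((real n + 1) * (real n + \<alpha> + \<beta> + 1) * (real n + \<alpha> + 1) * (real n + \<beta> + 1)))"
proof -
  have v: "v > 2" and nu: "real n + \<alpha> + \<beta> + 1 > 0"
    using assms(1-3) by (auto simp: v_def)
  \<comment> \<open>Passing from \<open>n\<close> to \<open>Suc n\<close> raises the upper index by
    two and the lower one by one: one absorption identity changes both, the next only the upper
    one.\<close>
  have 1: "(real n + 1) * (v gchoose Suc n) = v * ((v - 1) gchoose n)"
    using Suc_times_gbinomial[of n "v - 1"] by (simp add: algebra_simps)
  have "(real n + \<alpha> + \<beta> + 1) * ((v - 1) gchoose n) = (v - 1) * ((v - 2) gchoose n)"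
    using gbinomial_absorb_comp[of "v - 1" n] by (simp add: v_def algebra_simps)
  then have 2: "(v - 1) gchoose n = (v - 1) * ((v - 2) gchoose n) / (real n + \<alpha> + \<beta> + 1)"
    using nu by (simp add: eq_divide_eq mult.commute)
  have "v gchoose Suc n = v * ((v - 1) gchoose n) / (real n + 1)"
    unfolding 1[symmetric] by simp
  then have B: "(v gchoose Suc n) = v * (v - 1) * ((v - 2) gchoose n)
      / ((real n + 1) * (real n + \<alpha> + \<beta> + 1))"
    unfolding 2 by (simp add: mult.commute)
  have "Gamma (v + 2) = (v + 1) * (v * Gamma v)"
    using Gamma_add_one_pos[of "v + 1"] Gamma_add_one_pos[of v] v by (simp add: add.assoc)
  moreover have "Gamma (\<alpha> + real n + 1 + 1) = (\<alpha> + real n + 1) * Gamma (\<alpha> + real n + 1)"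
    using assms by (intro Gamma_add_one_pos) auto
  moreover have "Gamma (\<beta> + real n + 1 + 1) = (\<beta> + real n + 1) * Gamma (\<beta> + real n + 1)"
    using assms by (intro Gamma_add_one_pos) auto
  moreover have "2 * real (Suc n) + \<alpha> + \<beta> = v" "2 * real n + \<alpha> + \<beta> = v - 2"
    "\<alpha> + \<beta> + 2 + 2 * real (Suc n) = v + 2" "\<alpha> + \<beta> + 2 + 2 * real n = v"
    "\<alpha> + real (Suc n) + 1 = \<alpha> + real n + 1 + 1" "\<beta> + real (Suc n) + 1 = \<beta> + real n + 1 + 1"
    by (auto simp: v_def)
  ultimately show ?thesis
    unfolding jacobi_majorant_def
    by (simp only: B) (simp add: power2_eq_square algebra_simps)
qed

text \<open>Here \<open>u\<close> is the binomial coefficient itself, so the factors after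
  \<open>u\<^sup>2\<close> are the reciprocal of \<open>jacobi_h \<alpha> \<beta> 1\<close>. The
  last fraction recurs as \<open>G\<close> in all later bounds.\<close>

lemma jacobi_majorant_1:
  fixes \<alpha> \<beta> :: real
  assumes "\<alpha> > -1" and "\<beta> > -1"
  defines "u \<equiv> \<alpha> + \<beta> + 2"
  shows "jacobi_majorant \<alpha> \<beta> 1 =
    u\<^sup>2 * (u + 1) * (Gamma u / (2 powr (\<alpha> + \<beta> + 1) * Gamma (\<alpha> + 2) * Gamma (\<beta> + 2)))"
proof -
  have "u > 0" using assms by (simp add: u_def)
  then have "Gamma (u + 2) = (u + 1) * (u * Gamma u)"
    using Gamma_add_one_pos[of "u + 1"] Gamma_add_one_pos[of u] by (simp add: add.assoc)
  moreover have "2 * real 1 + \<alpha> + \<beta> = u" "\<alpha> + \<beta> + 2 + 2 * real 1 = u + 2"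
    "\<alpha> + real 1 + 1 = \<alpha> + 2" "\<beta> + real 1 + 1 = \<beta> + 2"
    by (auto simp: u_def)
  ultimately show ?thesis
    unfolding jacobi_majorant_def by (simp only: gbinomial_1) (simp add: power2_eq_square)
qed

section \<open>Decay of the majorant under the heat factor\<close>

text \<open>Equality holds at \<open>v = 4\<close>, \<open>t = 2 * ln 2\<close>. After taking square
  roots the claim is that \<open>4 * v\<close> is at most 2 to the power \<open>v\<close>, which
  follows from the tangent of the exponential at 4.\<close>

lemma power2_mult_exp_le:
  fixes t v :: real
  assumes "v \<ge> 4" and "t \<ge> 2 * ln 2"
  shows "v\<^sup>2 * exp (- (t * v)) \<le> 1 / 16"
proof -
  have "4 * v \<le> 16 * (1 + (v - 4) * (2/3))"
    using assms(1) by (simp add: field_simps)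
  also have "\<dots> \<le> 16 * (1 + (v - 4) * ln 2)"
    using assms(1) ln2_ge_two_thirds by (intro mult_left_mono add_mono) auto
  also have "\<dots> \<le> 16 * exp ((v - 4) * ln 2)"
    using exp_ge_add_one_self by (intro mult_left_mono) auto
  also have "\<dots> = exp (v * ln 2)"
  proof -
    have "(16 :: real) = exp (4 * ln 2)"
      by (simp add: exp_of_nat_mult[of 4, simplified])
    then show ?thesis
      by (simp only: exp_add[symmetric]) (simp add: algebra_simps)
  qed
  finally have "(4 * v)\<^sup>2 \<le> (exp (v * ln 2))\<^sup>2"
    using assms(1) by (intro power_mono) auto
  also have "\<dots> = exp (v * (2 * ln 2))"
    by (simp add: power2_eq_square exp_add[symmetric])
  also have "\<dots> \<le> exp (t * v)"
    using assms by (simp add: mult.commute mult_left_mono)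
  finally show ?thesis
    by (simp add: exp_minus field_simps)
qed

text \<open>Consecutive heat exponents differ by \<open>t * v\<close>, so the ratio is
  \<open>exp (- (t * v))\<close> times the rational factor of the recurrence. The former absorbs
  \<open>v\<^sup>2\<close> at the cost of 1/16, and what remains is at most 4/3.\<close>

lemma jacobi_majorant_heat_decay:
  fixes \<alpha> \<beta> t :: real
  assumes "\<alpha> > -1" and "\<beta> > -1" and "n \<ge> 2" and "t \<ge> 2 * ln 2"
  shows "exp (- t * real (Suc n) * (real (Suc n) + \<alpha> + \<beta> + 1)) * jacobi_majorant \<alpha> \<beta> (Suc n)
    \<le> exp (- t * real n * (real n + \<alpha> + \<beta> + 1)) * jacobi_majorant \<alpha> \<beta> n * (1 / 12)"
proof -
  define v where "v = 2 * real n + \<alpha> + \<beta> + 2"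
  define D where "D = (real n + 1) * (real n + \<alpha> + \<beta> + 1) * ((real n + \<alpha> + 1) * (real n + \<beta> + 1))"
  have n: "real n \<ge> 2" using assms(3) by simp
  have v: "v \<ge> 4" using n assms by (simp add: v_def)
  define u where "u = \<alpha> + \<beta> + 2"
  have u: "u > 0" "v = 2 * real n + u" using assms by (auto simp: u_def v_def)
  have nn: "real n * real n \<ge> 2 * real n"
    using n by (intro mult_right_mono) auto
  have nu: "real n * u \<ge> 2 * u"
    using n u by (intro mult_right_mono) auto
  have "(real n + 1) * (real n + \<alpha> + \<beta> + 1) = real n * real n + real n * u + u - 1"
    by (simp add: u_def algebra_simps)
  \<comment> \<open>The constant 3/4 is the limiting ratio at \<open>n = 2\<close> as
    \<open>u\<close> tends to 0.\<close>
  then have A: "3 / 4 * v \<le> (real n + 1) * (real n + \<alpha> + \<beta> + 1)"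
    using nn nu n u by linarith
  have B: "v \<le> (real n + \<alpha> + 1) * (real n + \<beta> + 1)"
  proof -
    have "(real n + \<alpha> + 1) * (real n + \<beta> + 1) = real n * real n + real n * u + (\<alpha> + 1) * (\<beta> + 1)"
      by (simp add: u_def algebra_simps)
    moreover have "(\<alpha> + 1) * (\<beta> + 1) \<ge> 0" using assms by simp
    ultimately show ?thesis using nn nu u by linarith
  qed
  have D: "D \<ge> 3 / 4 * v * v"
    unfolding D_def by (rule mult_mono[OF A B]) (use A v in linarith)+
  have maj: "jacobi_majorant \<alpha> \<beta> n \<ge> 0"
    using jacobi_h_pos[of \<alpha> \<beta> n] assms by (simp add: jacobi_majorant_eq)
  have Dp: "D > 0" using D v by (smt (verit) mult_pos_pos divide_pos_pos)
  have "exp (- (t * v)) * (v\<^sup>2 * (v\<^sup>2 - 1) / D) = v\<^sup>2 * exp (- (t * v)) * ((v\<^sup>2 - 1) / D)"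
    by simp
  also have "\<dots> \<le> 1 / 16 * (4 / 3)"
  proof (intro mult_mono power2_mult_exp_le v assms)
    show "(v\<^sup>2 - 1) / D \<le> 4 / 3"
      using D Dp by (simp add: field_simps power2_eq_square)
    have "1 \<le> v\<^sup>2" using v by (intro one_le_power) auto
    then show "0 \<le> (v\<^sup>2 - 1) / D" using Dp by simp
  qed auto
  finally have "exp (- (t * v)) * (v\<^sup>2 * (v\<^sup>2 - 1) / D) \<le> 1 / 12" by simp
  then have "exp (- t * real n * (real n + \<alpha> + \<beta> + 1)) * jacobi_majorant \<alpha> \<beta> n *
      (exp (- (t * v)) * (v\<^sup>2 * (v\<^sup>2 - 1) / D))
    \<le> exp (- t * real n * (real n + \<alpha> + \<beta> + 1)) * jacobi_majorant \<alpha> \<beta> n * (1 / 12)"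
    using maj by (intro mult_left_mono) auto
  moreover have "- t * real (Suc n) * (real (Suc n) + \<alpha> + \<beta> + 1) =
      - t * real n * (real n + \<alpha> + \<beta> + 1) + - (t * v)"
    by (simp add: v_def algebra_simps)
  moreover have "jacobi_majorant \<alpha> \<beta> (Suc n) = jacobi_majorant \<alpha> \<beta> n * (v\<^sup>2 * (v\<^sup>2 - 1) / D)"
    using jacobi_majorant_Suc[of \<alpha> \<beta> n] assms by (simp add: v_def D_def mult.assoc)
  ultimately show ?thesis
    by (simp only: exp_add) (simp add: mult_ac)
qed

lemma mult_add_one_le_exp:
  fixes u :: real
  assumes "u \<ge> 0"
  shows "u * (u + 1) \<le> exp u"
proof -
  \<comment> \<open>The right-hand side is 64 times the difference between the squared quadratic
    Taylor polynomial of \<open>exp (u / 2)\<close> and \<open>u * (u + 1)\<close>.\<close>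
  have "0 \<le> (u\<^sup>2 - 4)\<^sup>2 + 8 * (u - 2)\<^sup>2 * (u + 1) + 16"
    using assms by simp
  then have "u * (u + 1) \<le> (1 + u / 2 + (u / 2)\<^sup>2 / 2)\<^sup>2"
    by (simp add: power2_eq_square field_simps)
  also have "\<dots> \<le> (exp (u / 2))\<^sup>2"
    using assms exp_lower_Taylor_quadratic[of "u / 2"] by (intro power_mono) auto
  finally show ?thesis
    by (simp add: power2_eq_square exp_add[symmetric])
qed

text \<open>The heat exponent splits as \<open>t * u\<close> plus \<open>t * (u + 2)\<close>. The
  first part is the wanted decay; the second yields 1/16 and \<open>exp (- (u * (4 / 3)))\<close>.
  Against the majorant bound \<open>12 * w * G * exp (u * (7 / 3))\<close> this leaves the factor
  3/4 and one spare \<open>exp u\<close>, which turns \<open>t\<close> into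
  \<open>t - 1\<close>.\<close>

lemma jacobi_majorant_2_heat_le:
  fixes \<alpha> \<beta> t :: real
  assumes "\<alpha> > -1" and "\<beta> > -1" and "t \<ge> 2 * ln 2"
  defines "u \<equiv> \<alpha> + \<beta> + 2"
  shows "exp (- t * 2 * (2 + \<alpha> + \<beta> + 1)) * jacobi_majorant \<alpha> \<beta> 2
    \<le> 3 / 4 * (max \<alpha> \<beta> + 1) * (Gamma u / (2 powr (\<alpha> + \<beta> + 1) * Gamma (\<alpha> + 2) * Gamma (\<beta> + 2)))
        * exp (- (t - 1) * u)"
proof -
  define G where "G = Gamma u / (2 powr (\<alpha> + \<beta> + 1) * Gamma (\<alpha> + 2) * Gamma (\<beta> + 2))"
  define w where "w = max \<alpha> \<beta> + 1"
  have u: "u > 0" using assms by (simp add: u_def)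
  have G: "G > 0" unfolding G_def using assms u
    by (intro divide_pos_pos mult_pos_pos Gamma_real_pos) auto
  have uw: "u \<le> 2 * w" "w > 0" using assms(1,2) by (auto simp: u_def w_def)
  \<comment> \<open>This product is a denominator in the recurrence; its lower bound cancels one of
    the two factors \<open>u + 1\<close> in the numerator.\<close>
  have prod: "(\<alpha> + 2) * (\<beta> + 2) \<ge> u + 1"
  proof -
    have "(\<alpha> + 1) * (\<beta> + 1) \<ge> 0" using assms by simp
    then show ?thesis by (simp add: u_def algebra_simps)
  qed
  have "jacobi_majorant \<alpha> \<beta> 2 = u\<^sup>2 * (u + 1) * G * ((u + 2)\<^sup>2 * ((u + 2)\<^sup>2 - 1)
      / (2 * u * ((\<alpha> + 2) * (\<beta> + 2))))"
  proof -
    have "1 + 1 = (2 :: real)" "1 + \<alpha> + \<beta> + 1 = u" "1 + \<alpha> + 1 = \<alpha> + 2" "1 + \<beta> + 1 = \<beta> + 2"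
      "2 * 1 + \<alpha> + \<beta> + 2 = u + 2"
      by (auto simp: u_def)
    then show ?thesis
      using jacobi_majorant_Suc[OF assms(1,2), of 1] jacobi_majorant_1[OF assms(1,2)]
      unfolding u_def[symmetric] G_def[symmetric]
      by (simp only: Suc_1 of_nat_1 le_refl mult.assoc)
  qed
  also have "\<dots> = u * (u + 1)\<^sup>2 * (u + 2)\<^sup>2 * (u + 3) * G / 2 / ((\<alpha> + 2) * (\<beta> + 2))"
  proof -
    have "(u + 2)\<^sup>2 - 1 = (u + 1) * (u + 3)"
      by (simp add: power2_eq_square algebra_simps)
    then show ?thesis using u by (simp add: power2_eq_square)
  qed
  also have "\<dots> \<le> u * (u + 1)\<^sup>2 * (u + 2)\<^sup>2 * (u + 3) * G / 2 / (u + 1)"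
    using prod u G assms(1,2) by (intro divide_left_mono mult_pos_pos) auto
  also have "\<dots> = u * ((u + 1) * (u + 2)\<^sup>2 * (u + 3) * G / 2)"
    using u by (simp add: power2_eq_square field_simps)
  \<comment> \<open>Trading the isolated \<open>u\<close> for \<open>2 * w\<close> supplies the
    factor \<open>w\<close> of the final bound.\<close>
  also have "\<dots> \<le> 2 * w * ((u + 1) * (u + 2)\<^sup>2 * (u + 3) * G / 2)"
    using uw u G by (intro mult_right_mono) auto
  also have "\<dots> = 12 * w * G * ((1 + u) * (1 + u / 2) * ((1 + u / 2) * (1 + u / 3)))"
    by (simp add: power2_eq_square field_simps)
  \<comment> \<open>Each linear factor lies below an exponential; the rates 1, 1/2, 1/2 and 1/3 add
    up to 7/3.\<close>
  also have "\<dots> \<le> 12 * w * G * ((exp u * exp (u / 2)) * (exp (u / 2) * exp (u / 3)))"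
    using uw u G by (intro mult_mono mult_left_mono exp_ge_add_one_self) auto
  also have "\<dots> = 12 * w * G * exp (u * (7 / 3))"
    by (simp add: exp_add[symmetric])
  finally have maj: "jacobi_majorant \<alpha> \<beta> 2 \<le> 12 * w * G * exp (u * (7 / 3))" .
  have "exp (- t * 2 * (2 + \<alpha> + \<beta> + 1)) = exp (- (t * u)) * exp (- (t * (u + 2)))"
    unfolding exp_add[symmetric] by (simp add: u_def algebra_simps)
  also have "exp (- (t * (u + 2))) \<le> exp (- (2 * ln 2 * (u + 2)))"
    using assms(3) u by (simp add: mult_right_mono)
  also have "\<dots> = exp (- (4 * ln 2)) * exp (- (2 * ln 2 * u))"
    unfolding exp_add[symmetric] by (simp add: algebra_simps)
  also have "exp (- (4 * ln 2)) = (1 / 16 :: real)"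
    by (simp add: exp_minus exp_of_nat_mult[of 4, simplified])
  also have "exp (- (2 * ln 2 * u)) \<le> exp (- (u * (4 / 3)))"
  proof -
    have "2 * ln 2 * u \<ge> 4 / 3 * u"
      using u ln2_ge_two_thirds by (intro mult_right_mono) auto
    then show ?thesis by simp
  qed
  finally have "exp (- t * 2 * (2 + \<alpha> + \<beta> + 1)) \<le>
      exp (- (t * u)) * (1 / 16 * exp (- (u * (4 / 3))))"
    by simp
  then have "exp (- t * 2 * (2 + \<alpha> + \<beta> + 1)) * jacobi_majorant \<alpha> \<beta> 2 \<le>
      exp (- (t * u)) * (1 / 16 * exp (- (u * (4 / 3)))) * (12 * w * G * exp (u * (7 / 3)))"
    using maj jacobi_h_pos[of \<alpha> \<beta> 2] assms
    by (intro mult_mono) (auto simp: jacobi_majorant_eq)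
  also have "\<dots> = 3 / 4 * w * G * (exp (- (t * u)) * exp (- (u * (4 / 3))) * exp (u * (7 / 3)))"
    by simp
  also have "exp (- (t * u)) * exp (- (u * (4 / 3))) * exp (u * (7 / 3)) = exp (- (t - 1) * u)"
    unfolding exp_add[symmetric] by (simp add: algebra_simps)
  finally show ?thesis
    by (simp add: w_def G_def)
qed

section \<open>Summing the series\<close>

lemma jacobi_heat_kernel_bound:
  fixes \<alpha> \<beta> t x y :: real
  assumes "\<alpha> > -1" and "\<beta> > -1" and "x \<in> {-1..1}" and "y \<in> {-1..1}" and "t \<ge> 2 * ln 2"
  defines "u \<equiv> \<alpha> + \<beta> + 2"
  shows "\<bar>jacobi_heat_kernel \<alpha> \<beta> t x y - 1 / jacobi_h \<alpha> \<beta> 0\<bar> \<le>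
    2 * (max \<alpha> \<beta> + 1) * (Gamma u / (2 powr (\<alpha> + \<beta> + 1) * Gamma (\<alpha> + 2) * Gamma (\<beta> + 2)))
      * exp (- (t - 1) * u)"
proof -
  define G where "G = Gamma u / (2 powr (\<alpha> + \<beta> + 1) * Gamma (\<alpha> + 2) * Gamma (\<beta> + 2))"
  define w where "w = max \<alpha> \<beta> + 1"
  define f where "f n = exp (- t * real n * (real n + \<alpha> + \<beta> + 1))
    * (jacobi_poly \<alpha> \<beta> n x * jacobi_poly \<alpha> \<beta> n y / jacobi_h \<alpha> \<beta> n)" for n
  define a where "a n = exp (- t * real n * (real n + \<alpha> + \<beta> + 1)) * jacobi_majorant \<alpha> \<beta> n" for n
  have u: "u > 0" using assms by (simp add: u_def)
  have w: "0 < w" "w \<le> u" using assms(1,2) by (auto simp: u_def w_def)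
  have G: "G > 0" unfolding G_def using assms u
    by (intro divide_pos_pos mult_pos_pos Gamma_real_pos) auto

  have f_le: "\<bar>f n\<bar> \<le> a n" if "n \<ge> 1" for n
    unfolding f_def a_def abs_mult[of "exp _"] abs_exp_cancel
    using abs_jacobi_poly_mult_le[OF assms(1-4) that] by (intro mult_left_mono) auto
  have geo: "a (n + 2) \<le> a 2 * (1 / 12) ^ n" for n
  proof (induction n)
    case (Suc n)
    have "a (Suc n + 2) \<le> a (n + 2) * (1 / 12)"
      using jacobi_majorant_heat_decay[OF assms(1,2) _ assms(5), of "n + 2"] by (simp add: a_def)
    with Suc show ?case by simp
  qed (simp add: numeral_2_eq_2)
  have tail: "\<bar>f (n + 2)\<bar> \<le> a 2 * (1 / 12) ^ n" for n
    using f_le[of "n + 2"] geo[of n] by simp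
  have sg: "summable (\<lambda>n. a 2 * (1 / 12) ^ n)"
    by (intro summable_mult summable_geometric) auto
  have sabs: "summable (\<lambda>n. \<bar>f (n + 2)\<bar>)"
    using tail by (intro summable_comparison_test'[OF sg]) auto
  \<comment> \<open>Convergence is what permits splitting the first two terms off the series
    below.\<close>
  have sum_f: "summable f"
    using summable_rabs_cancel[OF sabs] by (subst (asm) summable_iff_shift)
  have "\<bar>\<Sum>n. f (n + 2)\<bar> \<le> (\<Sum>n. \<bar>f (n + 2)\<bar>)"
    by (rule summable_rabs[OF sabs])
  also have "\<dots> \<le> (\<Sum>n. a 2 * (1 / 12) ^ n)"
    by (rule suminf_le[OF tail sabs sg])
  also have "\<dots> = a 2 * (12 / 11)"
    by (subst suminf_mult) (auto intro!: summable_geometric simp: suminf_geometric)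
  also have "\<dots> \<le> 3 / 4 * w * G * exp (- (t - 1) * u) * (12 / 11)"
    using jacobi_majorant_2_heat_le[OF assms(1,2,5)]
    by (intro mult_right_mono) (auto simp: a_def w_def G_def u_def)
  \<comment> \<open>The geometric series with ratio 1/12 turns 3/4 into 9/11, which is below
    1.\<close>
  also have "\<dots> \<le> w * G * exp (- (t - 1) * u)"
    using w G by simp
  finally have f2: "\<bar>\<Sum>n. f (n + 2)\<bar> \<le> w * G * exp (- (t - 1) * u)" .

  \<comment> \<open>The two expressions for the majorant share the factor \<open>u\<^sup>2\<close>;
    cancelling it isolates the norm.\<close>
  have "1 / jacobi_h \<alpha> \<beta> 1 = (u + 1) * G"
  proof -
    have "jacobi_majorant \<alpha> \<beta> 1 = u\<^sup>2 * (1 / jacobi_h \<alpha> \<beta> 1)"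
      unfolding jacobi_majorant_eq[OF assms(1,2) order_refl] by (simp add: u_def add_ac)
    moreover have "jacobi_majorant \<alpha> \<beta> 1 = u\<^sup>2 * ((u + 1) * G)"
      using jacobi_majorant_1[OF assms(1,2)] by (simp only: u_def G_def mult.assoc)
    ultimately have "u\<^sup>2 * (1 / jacobi_h \<alpha> \<beta> 1) = u\<^sup>2 * ((u + 1) * G)"
      by (simp only:)
    then show ?thesis
      using u by (simp only: mult_cancel_left) simp
  qed
  moreover have "f 1 = exp (- (t * u)) * (1 / jacobi_h \<alpha> \<beta> 1)
      * (jacobi_poly \<alpha> \<beta> 1 x * jacobi_poly \<alpha> \<beta> 1 y)"
    by (simp add: f_def u_def add_ac)
  ultimately have "\<bar>f 1\<bar> = exp (- (t * u)) * ((u + 1) * G)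
      * (\<bar>jacobi_poly \<alpha> \<beta> 1 x\<bar> * \<bar>jacobi_poly \<alpha> \<beta> 1 y\<bar>)"
    using u G by (simp add: abs_mult)
  also have "\<dots> \<le> exp (- (t * u)) * ((u + 1) * G) * (w * w)"
    using u G w abs_jacobi_poly_1_le[OF assms(1,2,3)] abs_jacobi_poly_1_le[OF assms(1,2,4)]
    by (intro mult_left_mono mult_mono) (auto simp: w_def)
  also have "\<dots> = w * G * exp (- (t * u)) * (w * (u + 1))"
    by simp
  \<comment> \<open>Since \<open>w \<le> u\<close>, the surplus \<open>w * (u + 1)\<close> costs at
    most one \<open>exp u\<close>, which again turns \<open>t\<close> into
    \<open>t - 1\<close>.\<close>
  also have "\<dots> \<le> w * G * exp (- (t * u)) * exp u"
  proof (intro mult_left_mono)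
    have "w * (u + 1) \<le> u * (u + 1)"
      using w u by (intro mult_right_mono) auto
    then show "w * (u + 1) \<le> exp u"
      using mult_add_one_le_exp[of u] u by linarith
  qed (use w G in auto)
  also have "\<dots> = w * G * exp (- (t - 1) * u)"
    by (simp add: mult.assoc exp_add[symmetric]) (simp add: algebra_simps)
  finally have f1: "\<bar>f 1\<bar> \<le> w * G * exp (- (t - 1) * u)" .

  have "f 0 = 1 / jacobi_h \<alpha> \<beta> 0"
    by (simp add: f_def jacobi_poly_0)
  moreover have "jacobi_heat_kernel \<alpha> \<beta> t x y = (\<Sum>n. f n)"
    unfolding jacobi_heat_kernel_def f_def ..
  moreover have "(\<Sum>n. f n) = (\<Sum>n. f (n + 2)) + (f 0 + f 1)"
    using suminf_split_initial_segment[OF sum_f, of 2] by (simp add: eval_nat_numeral)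
  ultimately have "\<bar>jacobi_heat_kernel \<alpha> \<beta> t x y - 1 / jacobi_h \<alpha> \<beta> 0\<bar> \<le>
      2 * (w * G * exp (- (t - 1) * u))"
    using f1 f2 by simp
  then show ?thesis
    by (simp only: w_def G_def mult.assoc)
qed

section \<open>The bounds in the two parameter ranges\<close>

theorem theorem3:
  fixes \<alpha> \<beta> t x y :: real
  assumes "\<alpha> > -1" and "\<beta> > -1"
    and "x \<in> {-1..1}" and "y \<in> {-1..1}"
    and "t \<ge> 2 * ln 2"
  shows "(max \<alpha> \<beta> \<ge> - 1 / 2 \<longrightarrow>
            \<bar>jacobi_heat_kernel \<alpha> \<beta> t x y - 1 / jacobi_h \<alpha> \<beta> 0\<bar>
              \<le> Gamma (\<alpha> + \<beta> + 2)
                  / (2 powr (\<alpha> + \<beta>) * Gamma (min \<alpha> \<beta> + 2) * Gamma (max \<alpha> \<beta> + 1))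
                * exp (- (t - 1) * (\<alpha> + \<beta> + 2)))
       \<and> (max \<alpha> \<beta> < - 1 / 2 \<longrightarrow>
            \<bar>jacobi_heat_kernel \<alpha> \<beta> t x y - 1 / jacobi_h \<alpha> \<beta> 0\<bar>
              \<le> 27 * Gamma (\<alpha> + \<beta> + 2)
                  / (5 * 2 powr (\<alpha> + \<beta> + 2) * Gamma (\<alpha> + 2) * Gamma (\<beta> + 2))
                * exp (- (t - 1) * (\<alpha> + \<beta> + 2)))"
proof -
  define w where "w = max \<alpha> \<beta> + 1"
  define G where "G = Gamma (\<alpha> + \<beta> + 2) / (2 powr (\<alpha> + \<beta> + 1) * Gamma (\<alpha> + 2) * Gamma (\<beta> + 2))"
  have w: "w > 0" using assms by (simp add: w_def)
  have G: "G > 0" unfolding G_def using assms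
    by (intro divide_pos_pos mult_pos_pos Gamma_real_pos) auto
  have bound: "\<bar>jacobi_heat_kernel \<alpha> \<beta> t x y - 1 / jacobi_h \<alpha> \<beta> 0\<bar>
      \<le> 2 * w * G * exp (- (t - 1) * (\<alpha> + \<beta> + 2))"
    using jacobi_heat_kernel_bound[OF assms] by (simp add: w_def G_def)
  \<comment> \<open>The factor \<open>w\<close> lowers the Gamma value at
    \<open>max \<alpha> \<beta> + 2\<close> to the one at \<open>max \<alpha> \<beta> + 1\<close>;
    this turns \<open>2 * w * G\<close> into the first constant.\<close>
  have "Gamma (w + 1) = w * Gamma w"
    using w by (intro Gamma_add_one_pos)
  moreover have "Gamma w > 0" using w by simp
  moreover have "Gamma (\<alpha> + 2) * Gamma (\<beta> + 2) = Gamma (min \<alpha> \<beta> + 2) * Gamma (w + 1)"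
    by (simp add: w_def min_def max_def add.assoc)
  ultimately have "Gamma (\<alpha> + \<beta> + 2) / (2 powr (\<alpha> + \<beta>) * Gamma (min \<alpha> \<beta> + 2) * Gamma (max \<alpha> \<beta> + 1))
      = 2 * w * G"
    using w by (simp add: G_def powr_add mult.assoc) (simp add: w_def)
  then have "\<bar>jacobi_heat_kernel \<alpha> \<beta> t x y - 1 / jacobi_h \<alpha> \<beta> 0\<bar>
      \<le> Gamma (\<alpha> + \<beta> + 2) / (2 powr (\<alpha> + \<beta>) * Gamma (min \<alpha> \<beta> + 2) * Gamma (max \<alpha> \<beta> + 1))
        * exp (- (t - 1) * (\<alpha> + \<beta> + 2))"
    using bound by simp
  moreover have "2 * w * G * exp (- (t - 1) * (\<alpha> + \<beta> + 2)) \<le> 27 * Gamma (\<alpha> + \<beta> + 2)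
      / (5 * 2 powr (\<alpha> + \<beta> + 2) * Gamma (\<alpha> + 2) * Gamma (\<beta> + 2))
      * exp (- (t - 1) * (\<alpha> + \<beta> + 2))" if "max \<alpha> \<beta> < - 1 / 2"
  proof (intro mult_right_mono)
    \<comment> \<open>Here \<open>2 * w < 1\<close>. The 27/10 is 27/5 halved, as the stated
      constant carries one more power of 2 in its denominator than \<open>G\<close>.\<close>
    have "2 * w * G \<le> 27 / 10 * G"
      using that G by (intro mult_right_mono) (auto simp: w_def)
    also have "\<dots> = 27 * Gamma (\<alpha> + \<beta> + 2)
        / (5 * 2 powr (\<alpha> + \<beta> + 2) * Gamma (\<alpha> + 2) * Gamma (\<beta> + 2))"
      by (simp add: G_def powr_add)
    finally show "2 * w * G \<le> 27 * Gamma (\<alpha> + \<beta> + 2)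
        / (5 * 2 powr (\<alpha> + \<beta> + 2) * Gamma (\<alpha> + 2) * Gamma (\<beta> + 2))" .
  qed simp
  ultimately show ?thesis
    using order_trans[OF bound] by blast
qed

end
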